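(* Given a Candy Nim game $G$ with $N(G)\ge 1$, we have $N_W(G) \ge \lfloor \log_2(N(G)) \rfloor$. Equality is achieved only when $N(G) = 2^n$, $2^n - 2$, or $2^n - 2^k - 2$, for positive integers $n, k$ with $n > k + 1$ and $n > 2$, in the following arrangements: 1. $N(G) = 2^n$ and $G = [1,1,1,2,4,8,\ldots,2^{n-2},2^{n-1}-1]$, that is, the piles are two piles of size $1$, the piles $2^0,2^1,\dots,2^{n-2}$, and one pile of size $2^{n-1}-1$; 2. $N(G) = 2^n - 2$ and $G = [1,2,4,8,\ldots,2^{n-2},2^{n-1}-1]$, that is, the piles are $2^0,2^1,\dots,2^{n-2}$ and one pile of size $2^{n-1}-1$; 3. $N(G) = 2^n - 2^k - 2$ and $G = [1,2,4,8,\ldots,2^{k-2},2^k, \ldots ,2^{n-2},2^{n-1}-1-2^{k-1}]$, that is, the piles are the powers $2^i$ with $0\le i\le n-2$, $i\ne k-1$, together with one pile of size $2^{n-1}-1-2^{k-1}$.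
   Context: Candy Nim is played with the positions and moves of Nim: a position (game) $[a_1,\dots,a_p]$ consists of $p$ piles, the $i$-th having $a_i \ge 0$ candies (the order of the piles and empty piles are immaterial), and in a move a player removes a positive number of candies from one pile. Two players alternate; the player taking the last candy wins. A position is a $\mathcal{P}$ position if the bitwise XOR (nim-sum) $a_1\oplus\cdots\oplus a_p$ is $0$ (the player to move loses the underlying Nim game under optimal play), and an $\mathcal{N}$ position otherwise. The losing player is called Luca and the winning player Windsor: in a $\mathcal{P}$ position it is Luca's turn, in an $\mathcal{N}$ position it is Windsor's turn. Luca may make any move; Windsor is forced to make winning Nim moves, i.e. each of his moves must lead to a $\mathcal{P}$ position. Subject to this, each player tries to collect as many candies as possible. For a position $G$, $N(G)$ is the total number of candies in $G$, and $N_W(G)$ is the number of candies collected by Windsor under optimal play by both players.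
   Formalization: The condition n > 2 is imposed only on the third form; the first two forms allow every positive n, since [1,1] and [1,1,1,1] attain equality but would be excluded by n > 2. *)

theory Defs
  imports Complex_Main "HOL-Library.Multiset"
begin

unbundle bit_operations_syntax

text \<open>
  A position is the multiset of its pile sizes. Empty piles are allowed in it; positions that
  differ only in empty piles are identified by \<open>same_position\<close>.
\<close>

type_synonym position = "nat multiset"

definition same_position :: "position \<Rightarrow> position \<Rightarrow> bool" where
  "same_position G H \<longleftrightarrow> {#a \<in># G. a > 0#} = {#a \<in># H. a > 0#}"

definition candies :: "position \<Rightarrow> nat" where
  "candies G = \<Sum>\<^sub># G"

definition nim_sum :: "position \<Rightarrow> nat" where
  "nim_sum G = fold_mset (XOR) 0 G"

lemma nim_sum_empty [simp]: "nim_sum {#} = 0"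
  by (simp add: nim_sum_def)

lemma nim_sum_add_mset [simp]: "nim_sum (add_mset a G) = a XOR nim_sum G"
proof -
  interpret comp_fun_commute "(XOR) :: nat \<Rightarrow> nat \<Rightarrow> nat"
    by standard (simp add: fun_eq_iff xor.left_commute)
  show ?thesis
    by (simp add: nim_sum_def)
qed

definition P_position :: "position \<Rightarrow> bool" where
  "P_position G \<longleftrightarrow> nim_sum G = 0"

text \<open>The pair \<open>(c, H)\<close> is the move that takes \<open>c\<close> candies and leaves \<open>H\<close>.\<close>

definition moves :: "position \<Rightarrow> (nat \<times> position) set" where
  "moves G = {(c, add_mset (a - c) (G - {#a#})) | a c. a \<in># G \<and> 0 < c \<and> c \<le> a}"

definition winning_moves :: "position \<Rightarrow> (nat \<times> position) set" where
  "winning_moves G = {(c, H) \<in> moves G. P_position H}"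

lemma finite_moves: "finite (moves G)"
proof (rule finite_subset)
  show "moves G \<subseteq> (\<lambda>(a, c). (c, add_mset (a - c) (G - {#a#}))) ` (SIGMA a : set_mset G. {..a})"
    by (auto simp: moves_def)
qed auto

lemma finite_winning_moves: "finite (winning_moves G)"
  by (rule finite_subset [OF _ finite_moves [of G]]) (auto simp: winning_moves_def)

lemma candies_move:
  assumes "(c, H) \<in> moves G"
  shows "c > 0" "candies G = c + candies H"
proof -
  from assms obtain a where a: "a \<in># G" "0 < c" "c \<le> a" "H = add_mset (a - c) (G - {#a#})"
    by (auto simp: moves_def)
  show "c > 0" by fact
  from a(1) have "candies G = a + candies (G - {#a#})"
    by (simp add: candies_def sum_mset.remove)
  with a show "candies G = c + candies H"
    by (simp add: candies_def)
qed

lemma candies_move_less: "(c, H) \<in> moves G \<Longrightarrow> candies H < candies G"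
  using candies_move [of c H G] by simp

lemma moves_empty_iff: "moves G = {} \<longleftrightarrow> candies G = 0"
proof
  assume "moves G = {}"
  then have "\<forall>a \<in># G. a = 0"
    by (auto simp: moves_def)
  then show "candies G = 0"
    by (simp add: candies_def)
next
  assume "candies G = 0"
  then show "moves G = {}"
    using candies_move by fastforce
qed

text \<open>
  Backward induction for the candies collected by Windsor. All candies are eventually taken, so
  Luca, who is to move exactly in the \<open>P\<close> positions, maximises his own share by minimising
  Windsor's (see \<open>luca_candies_P\<close> below). Windsor is to move in the remaining positions and
  must choose among the winning moves; there always is one, since the nim-sum is not \<open>0\<close>.
\<close>

function windsor_candies :: "position \<Rightarrow> nat" where
  "windsor_candies G =
    (if moves G = {} then 0
     else if P_position G then Min ((\<lambda>(c, H). windsor_candies H) ` moves G)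
     else Max ((\<lambda>(c, H). c + windsor_candies H) ` winning_moves G))"
  by auto
termination
  by (relation "measure candies") (auto simp: winning_moves_def dest: candies_move_less)

declare windsor_candies.simps [simp del]

definition luca_candies :: "position \<Rightarrow> int" where
  "luca_candies G = int (candies G) - int (windsor_candies G)"

lemma luca_candies_P:
  assumes "P_position G" "moves G \<noteq> {}"
  shows "luca_candies G = Max ((\<lambda>(c, H). int c + luca_candies H) ` moves G)"
proof -
  let ?W = "(\<lambda>(c, H). windsor_candies H) ` moves G"
  have fin: "finite ?W" and ne: "?W \<noteq> {}"
    using finite_moves assms(2) by auto
  have W: "windsor_candies G = Min ?W"
    using assms by (subst windsor_candies.simps) simp
  have eq: "int c + luca_candies H = int (candies G) - int (windsor_candies H)"
    if "(c, H) \<in> moves G" for c H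
    using candies_move [OF that] by (simp add: luca_candies_def)
  show ?thesis
  proof (rule Max_eqI [symmetric])
    show "finite ((\<lambda>(c, H). int c + luca_candies H) ` moves G)"
      using finite_moves by simp
  next
    fix y
    assume "y \<in> (\<lambda>(c, H). int c + luca_candies H) ` moves G"
    then obtain c H where m: "(c, H) \<in> moves G" and y: "y = int c + luca_candies H"
      by auto
    have "windsor_candies H \<in> ?W"
      using m by force
    then have "windsor_candies G \<le> windsor_candies H"
      unfolding W using fin by simp
    then show "y \<le> luca_candies G"
      using eq [OF m] y by (simp add: luca_candies_def)
  next
    from Min_in [OF fin ne] obtain c H
      where m: "(c, H) \<in> moves G" and "windsor_candies G = windsor_candies H"
      unfolding W by auto
    then have "luca_candies G = int c + luca_candies H"
      using eq [OF m] by (simp add: luca_candies_def)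
    then show "luca_candies G \<in> (\<lambda>(c, H). int c + luca_candies H) ` moves G"
      using m by force
  qed
qed

text \<open>
  The three families of arrangements. The range \<open>2^0, \<dots>, 2^(n-2)\<close> is written with exponents
  \<open>i < n - 1\<close>, so that it is empty for \<open>n = 1\<close>.
\<close>

definition arrangement1 :: "nat \<Rightarrow> position" where
  "arrangement1 n =
    {#1, 1#} + image_mset (\<lambda>i. 2 ^ i) (mset_set {i. i < n - 1}) + {#2 ^ (n - 1) - 1#}"

definition arrangement2 :: "nat \<Rightarrow> position" where
  "arrangement2 n = image_mset (\<lambda>i. 2 ^ i) (mset_set {i. i < n - 1}) + {#2 ^ (n - 1) - 1#}"

definition arrangement3 :: "nat \<Rightarrow> nat \<Rightarrow> position" where
  "arrangement3 n k =
    image_mset (\<lambda>i. 2 ^ i) (mset_set {i. i < n - 1 \<and> i \<noteq> k - 1})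
      + {#2 ^ (n - 1) - 1 - 2 ^ (k - 1)#}"

end

theory Submission
  imports Defs
begin

text \<open>
  Write \<open>N\<close> for the number of candies of a position and \<open>W\<close> for Windsor's share of them.

  The bound is \<open>N < 2 ^ (W + 1)\<close>, and even \<open>N < 2 ^ W\<close> when Windsor is to move
  (\<open>candies_less_power_windsor\<close>). It rests on two facts about \<open>P\<close> positions: a pile holds at most
  half of the candies, so a move of Luca leaves at least half of them; and \<open>N\<close> is even. If Windsor
  answers by taking \<open>d\<close> candies and leaves \<open>H\<close> with share \<open>w\<close>, then \<open>N(H) \<le> 2 ^ (w + 1) - 2\<close> by
  induction and parity, and \<open>d + 2 ^ (w + 1) - 2 < 2 ^ (w + d)\<close>. Hence any winning reply will do.

  Equality in the theorem means \<open>2 ^ W \<le> N\<close>. That the three families satisfy it is shown by one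
  strategy of Luca (\<open>[1,1,1,1]\<close> is treated apart): he takes the pile listed last, in the third
  family leaving of it the missing power of two, so that what remains is \<open>2 ^ j\<close> together with
  piles below \<open>2 ^ j\<close> of nim-sum \<open>2 ^ j - 1\<close>. Windsor then has only one
  winning move, which takes a single candy, and the position left is the previous member of its
  family or a member of the second one (\<open>windsor_candies_descent\<close>).

  Conversely, if \<open>2 ^ W \<le> N\<close>, the slack in the estimates above is so small that, after an optimal
  move of Luca, all winning replies take exactly one candy and lead to positions that again
  satisfy equality; the only exceptions end the game at once, from \<open>[1,1]\<close> and \<open>[2,2]\<close>
  (\<open>extremal_if_tight\<close>). By induction these positions belong to the three families, and one round
  can be undone: Windsor's reply was \<open>b' + 1 \<mapsto> b'\<close> on one pile, so the nim-sum \<open>s\<close> before it was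
  \<open>(b' + 1) XOR b'\<close>, and Luca's move was \<open>a' XOR s \<mapsto> a'\<close> on another. Luca gains at most \<open>s\<close>.
  Coming to a position of the first or third family he must have gained much, so \<open>s\<close> is large and
  \<open>b' + 1\<close> is divisible by a large power of two: this leaves one choice of \<open>b'\<close> in the first
  family, which continues it, and none in the third. In the second family \<open>b'\<close> may be the largest
  pile, which yields the second and the third family; otherwise \<open>s = 1\<close> or \<open>s = 3\<close>. With these
  values \<open>[1,1]\<close> yields \<open>[1,1,1,1]\<close>, the origin of the first family, and every larger position is
  excluded because Windsor would have had another reply that takes three candies or leaves all
  families (\<open>extremal_step\<close>).
\<close>

section \<open>Binary digits\<close>

lemma xor_le_add: "(a::nat) XOR b \<le> a + b"
proof (induction a arbitrary: b rule: less_induct)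
  case (less a)
  show ?case
  proof (cases "a = 0")
    case False
    have "(a div 2) XOR (b div 2) \<le> a div 2 + b div 2"
      using less False by simp
    then show ?thesis
      by (subst xor_rec) (auto elim!: evenE oddE)
  qed simp
qed

lemma xor_left_self: "(a::nat) XOR (a XOR b) = b"
  by (simp add: xor.assoc [symmetric])

lemma xor_mask_eq: "(x::nat) < 2 ^ n \<Longrightarrow> x XOR (2 ^ n - 1) = 2 ^ n - 1 - x"
proof (induction n arbitrary: x)
  case (Suc n)
  have half: "(2 ^ Suc n - 1) div 2 = (2 ^ n - 1 :: nat)" and odd: "odd (2 ^ Suc n - 1 :: nat)"
    by simp_all
  have "(x div 2) XOR (2 ^ n - 1) = 2 ^ n - 1 - x div 2"
    using Suc by simp
  then show ?case
    using Suc.prems half odd by (subst xor_rec) (auto elim!: evenE oddE)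
qed simp

lemma top_power_xor_mask: "(2::nat) ^ n XOR (2 ^ n - 1) = 2 ^ Suc n - 1"
proof -
  have "(2::nat) ^ n XOR (2 ^ Suc n - 1) = 2 ^ n - 1"
    by (subst xor_mask_eq) simp_all
  then have "(2::nat) ^ n XOR (2 ^ n XOR (2 ^ Suc n - 1)) = 2 ^ n XOR (2 ^ n - 1)"
    by simp
  then show ?thesis
    by (simp add: xor.assoc [symmetric])
qed

text \<open>
  The classical choice of a pile in Nim: halving reduces the claim to the case where the top bit
  of \<open>s\<close> is its last one.
\<close>

lemma xor_less_if_top_bit:
  fixes x s :: nat
  assumes "bit x j" "bit s j" "s < 2 ^ Suc j"
  shows "x XOR s < x"
  using assms
proof (induction j arbitrary: x s)
  case 0
  then have "odd x" "s = 1"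
    by (auto simp: bit_0 less_2_cases_iff)
  then show ?case
    by (auto simp: xor_Suc_0_eq elim!: oddE)
next
  case (Suc j)
  have "(x div 2) XOR (s div 2) < x div 2"
    using Suc by (intro Suc.IH) (auto simp: bit_Suc)
  moreover have "(x XOR s) div 2 = (x div 2) XOR (s div 2)"
    using drop_bit_xor [of 1 x s] by (simp add: drop_bit_eq_div)
  ultimately show ?case
    by (metis div_le_mono not_less)
qed

text \<open>
  Passing from \<open>b\<close> to \<open>b + 1\<close> changes the bits up to the lowest set bit of \<open>b + 1\<close> and no others.
\<close>

lemma power_dvd_if_le_xor_Suc:
  fixes b :: nat
  assumes "2 ^ i \<le> Suc b XOR b"
  shows "2 ^ i dvd Suc b"
proof (rule ccontr)
  assume "\<not> 2 ^ i dvd Suc b"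
  then have "Suc b div 2 ^ i = b div 2 ^ i"
    by (simp add: div_Suc dvd_eq_mod_eq_0)
  then have "(Suc b XOR b) div 2 ^ i = 0"
    using drop_bit_xor [of i "Suc b" b] by (simp add: drop_bit_eq_div)
  then show False
    using assms by (simp add: div_eq_0_iff)
qed

section \<open>Nim-sums\<close>

lemma candies_add_mset [simp]: "candies (add_mset a G) = a + candies G"
  by (simp add: candies_def)

lemma candies_empty [simp]: "candies {#} = 0"
  by (simp add: candies_def)

lemma nim_sum_le_candies: "nim_sum G \<le> candies G"
proof (induction G)
  case (add a G)
  then show ?case
    using xor_le_add [of a "nim_sum G"] by simp
qed simp

lemma even_nim_sum_iff: "even (nim_sum G) \<longleftrightarrow> even (candies G)"
  by (induction G) (auto simp: even_xor_iff)

lemma even_candies_if_P: "P_position G \<Longrightarrow> even (candies G)"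
  using even_nim_sum_iff [of G] by (simp add: P_position_def)

lemma xor_eq_0_nat: "(a::nat) XOR b = 0 \<longleftrightarrow> a = b"
  by (metis xor.assoc xor.left_neutral xor.right_neutral xor_self_eq)

lemma nim_sum_eq_if_P_add_mset: "P_position (add_mset a R) \<Longrightarrow> nim_sum R = a"
  by (simp add: P_position_def xor_eq_0_nat)

text \<open>
  In a \<open>P\<close> position a pile equals the nim-sum of the others, which is at most their sum.
\<close>

lemma pile_le_half_if_P:
  assumes "P_position (add_mset a R)"
  shows "a \<le> candies R"
  using nim_sum_eq_if_P_add_mset [OF assms] nim_sum_le_candies [of R] by simp

lemma pile_with_bit_if_bit_nim_sum: "bit (nim_sum G) j \<Longrightarrow> \<exists>x \<in># G. bit x j"
  by (induction G) (auto simp: bit_xor_iff)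

lemma reducible_pile_exists:
  assumes "nim_sum G \<noteq> 0"
  shows "\<exists>x \<in># G. x XOR nim_sum G < x"
proof -
  obtain j where j: "2 ^ j \<le> nim_sum G" "nim_sum G < 2 ^ (j + 1)"
    using ex_power_ivl1 [of 2 "nim_sum G"] assms by auto
  then have "nim_sum G div 2 ^ j = 1"
    by (intro div_nat_eqI) auto
  then have bit: "bit (nim_sum G) j"
    by (simp add: bit_iff_odd)
  with pile_with_bit_if_bit_nim_sum obtain x where "x \<in># G" "bit x j"
    by blast
  with bit j show ?thesis
    using xor_less_if_top_bit by (metis Suc_eq_plus1)
qed

text \<open>
  Some pile has bit \<open>i\<close> set, and that pile already uses up all candies.
\<close>

lemma single_pile_if_power:
  assumes "nim_sum R = 2 ^ i" "candies R = 2 ^ i"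
  obtains Z where "R = add_mset (2 ^ i) Z" "candies Z = 0"
proof -
  have "bit (nim_sum R) i"
    by (simp add: assms bit_iff_odd)
  then obtain y where y: "y \<in># R" "bit y i"
    using pile_with_bit_if_bit_nim_sum by blast
  have "y div 2 ^ i \<noteq> 0"
    using y(2) by (metis bit_iff_odd even_zero)
  then have "2 ^ i \<le> y"
    by (simp add: div_eq_0_iff)
  moreover obtain Z where Z: "R = add_mset y Z"
    using y(1) by (metis insert_DiffM)
  ultimately have "y = 2 ^ i" "candies Z = 0"
    using assms(2) by simp_all
  with Z that show ?thesis
    by blast
qed

section \<open>Moves\<close>

lemma moves_iff:
  "(c, K) \<in> moves G \<longleftrightarrow>
    (\<exists>x R. G = add_mset x R \<and> K = add_mset (x - c) R \<and> 0 < c \<and> c \<le> x)"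
  by (auto simp: moves_def) (metis insert_DiffM, metis add_mset_remove_trivial union_single_eq_member)

text \<open>
  A winning move replaces a pile \<open>x\<close> by its nim-sum with the whole position; this determines
  the number of candies taken from each pile.
\<close>

lemma winning_moves_iff:
  "(d, H) \<in> winning_moves K \<longleftrightarrow>
    (\<exists>x R. K = add_mset x R \<and> H = add_mset (x XOR nim_sum K) R
      \<and> x XOR nim_sum K < x \<and> d = x - (x XOR nim_sum K))" (is "?lhs \<longleftrightarrow> ?rhs")
proof
  assume ?lhs
  then obtain x R where *: "K = add_mset x R" "H = add_mset (x - d) R" "0 < d" "d \<le> x"
    and P: "P_position H"
    by (auto simp: winning_moves_def moves_iff)
  have "nim_sum R = x - d"
    using P unfolding *(2) by (rule nim_sum_eq_if_P_add_mset)
  then have "x XOR nim_sum K = x - d"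
    by (simp add: *(1) xor.assoc [symmetric])
  with * show ?rhs
    by (intro exI [of _ x] exI [of _ R]) simp
next
  assume ?rhs
  then obtain x R where *: "K = add_mset x R" "H = add_mset (x XOR nim_sum K) R"
    "x XOR nim_sum K < x" "d = x - (x XOR nim_sum K)"
    by blast
  have "x XOR nim_sum K = nim_sum R"
    by (simp add: *(1) xor.assoc [symmetric])
  then have "P_position H"
    by (simp add: *(2) P_position_def)
  moreover have "(d, H) \<in> moves K"
    unfolding moves_iff using * by (intro exI [of _ x] exI [of _ R]) auto
  ultimately show ?lhs
    by (simp add: winning_moves_def)
qed

lemma winning_moveI:
  assumes "x \<in># K" "x XOR nim_sum K < x"
  shows "(x - (x XOR nim_sum K), add_mset (x XOR nim_sum K) (K - {#x#})) \<in> winning_moves K"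
  unfolding winning_moves_iff using assms
  by (intro exI [of _ x] exI [of _ "K - {#x#}"]) simp

lemma winning_moves_nonempty: "\<not> P_position K \<Longrightarrow> winning_moves K \<noteq> {}"
  using reducible_pile_exists [of K] winning_moveI [of _ K] by (auto simp: P_position_def)

lemma winning_moveD:
  assumes "(d, H) \<in> winning_moves K"
  shows "P_position H" "0 < d" "candies K = d + candies H"
  using assms candies_move [of d H K] by (auto simp: winning_moves_def)

lemma not_P_if_move_from_P:
  assumes "P_position G" "(c, K) \<in> moves G"
  shows "\<not> P_position K"
proof
  assume P: "P_position K"
  from assms(2) obtain x R where *: "G = add_mset x R" "K = add_mset (x - c) R" "0 < c" "c \<le> x"
    by (auto simp: moves_iff)
  have "nim_sum R = x" "nim_sum R = x - c"
    using P assms(1) unfolding * by (auto dest: nim_sum_eq_if_P_add_mset)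
  with * show False
    by simp
qed

section \<open>Windsor's share\<close>

lemma windsor_candies_0: "candies G = 0 \<Longrightarrow> windsor_candies G = 0"
  by (subst windsor_candies.simps) (simp add: moves_empty_iff)

lemma windsor_candies_le_if_move:
  assumes "P_position G" "(c, K) \<in> moves G"
  shows "windsor_candies G \<le> windsor_candies K"
proof -
  have "windsor_candies G = Min ((\<lambda>(c, H). windsor_candies H) ` moves G)"
    using assms by (subst windsor_candies.simps) auto
  also have "\<dots> \<le> windsor_candies K"
    using assms finite_moves by (intro Min_le) force+
  finally show ?thesis .
qed

lemma optimal_move_exists:
  assumes "P_position G" "0 < candies G"
  obtains c K where "(c, K) \<in> moves G" "windsor_candies G = windsor_candies K"
proof -
  have ne: "moves G \<noteq> {}"
    using assms by (simp add: moves_empty_iff)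
  have "windsor_candies G = Min ((\<lambda>(c, H). windsor_candies H) ` moves G)"
    using assms ne by (subst windsor_candies.simps) auto
  also have "\<dots> \<in> (\<lambda>(c, H). windsor_candies H) ` moves G"
    using ne finite_moves by (intro Min_in) auto
  finally show ?thesis
    using that by auto
qed

lemma windsor_candies_N:
  assumes "\<not> P_position K"
  shows "windsor_candies K = Max ((\<lambda>(d, H). d + windsor_candies H) ` winning_moves K)"
  using assms winning_moves_nonempty [OF assms]
  by (subst windsor_candies.simps) (auto simp: winning_moves_def)

lemma windsor_candies_ge_if_winning_move:
  assumes "\<not> P_position K" "(d, H) \<in> winning_moves K"
  shows "d + windsor_candies H \<le> windsor_candies K"
  unfolding windsor_candies_N [OF assms(1)]
  using assms(2) finite_winning_moves by (intro Max_ge) force+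

lemma windsor_candies_N_leI:
  assumes "\<not> P_position K"
    and "\<And>d H. (d, H) \<in> winning_moves K \<Longrightarrow> d + windsor_candies H \<le> m"
  shows "windsor_candies K \<le> m"
  unfolding windsor_candies_N [OF assms(1)]
  using assms(2) finite_winning_moves winning_moves_nonempty [OF assms(1)]
  by (subst Max_le_iff) auto

lemma windsor_candies_P_leI:
  assumes "P_position G" "(c, K) \<in> moves G"
    and "\<And>d H. (d, H) \<in> winning_moves K \<Longrightarrow> d + windsor_candies H \<le> m"
  shows "windsor_candies G \<le> m"
  using windsor_candies_le_if_move [OF assms(1,2)]
    windsor_candies_N_leI [OF not_P_if_move_from_P [OF assms(1,2)] assms(3)]
  by linarith

lemma moves_add_empty_pile: "moves (add_mset 0 G) = (\<lambda>(c, H). (c, add_mset 0 H)) ` moves G"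
proof -
  have "(c, K) \<in> moves (add_mset 0 G) \<longleftrightarrow> (\<exists>H. (c, H) \<in> moves G \<and> K = add_mset 0 H)" for c K
  proof
    assume "(c, K) \<in> moves (add_mset 0 G)"
    then obtain x R where *: "add_mset 0 G = add_mset x R" "K = add_mset (x - c) R" "0 < c" "c \<le> x"
      by (auto simp: moves_iff)
    then obtain R' where "G = add_mset x R'" "R = add_mset 0 R'"
      by (auto simp: add_eq_conv_ex)
    with * show "\<exists>H. (c, H) \<in> moves G \<and> K = add_mset 0 H"
      by (intro exI [of _ "add_mset (x - c) R'"]) (auto simp: moves_iff add_mset_commute)
  next
    assume "\<exists>H. (c, H) \<in> moves G \<and> K = add_mset 0 H"
    then show "(c, K) \<in> moves (add_mset 0 G)"
      by (auto simp: moves_iff) (metis add_mset_commute)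
  qed
  then show ?thesis
    by auto
qed

lemma P_position_add_empty_pile: "P_position (add_mset 0 G) \<longleftrightarrow> P_position G"
  by (simp add: P_position_def)

lemma winning_moves_add_empty_pile:
  "winning_moves (add_mset 0 G) = (\<lambda>(c, H). (c, add_mset 0 H)) ` winning_moves G"
  by (auto simp: winning_moves_def moves_add_empty_pile P_position_add_empty_pile)

text \<open>
  Together with the next lemmas this makes Windsor's share a function of the position up to
  empty piles, so the arrangements need to be analysed only as the multisets given.
\<close>

lemma windsor_candies_add_empty_pile: "windsor_candies (add_mset 0 G) = windsor_candies G"
proof (induction "candies G" arbitrary: G rule: less_induct)
  case less
  have *: "windsor_candies (add_mset 0 H) = windsor_candies H" if "(c, H) \<in> moves G" for c H
    using less candies_move_less [OF that] by simp
  have 1: "(\<lambda>(c, H). windsor_candies H) ` moves (add_mset 0 G)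
      = (\<lambda>(c, H). windsor_candies H) ` moves G"
    unfolding moves_add_empty_pile image_image using * by (intro image_cong) auto
  have 2: "(\<lambda>(c, H). c + windsor_candies H) ` winning_moves (add_mset 0 G)
      = (\<lambda>(c, H). c + windsor_candies H) ` winning_moves G"
    unfolding winning_moves_add_empty_pile image_image
    using * by (intro image_cong) (auto simp: winning_moves_def)
  have 3: "moves (add_mset 0 G) = {} \<longleftrightarrow> moves G = {}"
    by (simp add: moves_empty_iff)
  show ?case
    by (subst (1 2) windsor_candies.simps) (simp only: 1 2 3 P_position_add_empty_pile)
qed

lemma windsor_candies_add_empty_piles:
  "windsor_candies (replicate_mset z 0 + G) = windsor_candies G"
  by (induction z) (simp_all add: windsor_candies_add_empty_pile)

lemma windsor_candies_nonempty_piles: "windsor_candies {#a \<in># G. a > 0#} = windsor_candies G"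
proof -
  have "G = replicate_mset (count G 0) 0 + {#a \<in># G. a > 0#}"
    by (rule multiset_eqI) auto
  then show ?thesis
    using windsor_candies_add_empty_piles [of "count G 0" "{#a \<in># G. a > 0#}"] by simp
qed

lemma windsor_candies_same_position:
  "same_position G H \<Longrightarrow> windsor_candies G = windsor_candies H"
  by (metis same_position_def windsor_candies_nonempty_piles)

lemma candies_nonempty_piles: "candies {#a \<in># G. a > 0#} = candies G"
  by (induction G) auto

lemma candies_same_position: "same_position G H \<Longrightarrow> candies G = candies H"
  by (metis same_position_def candies_nonempty_piles)

section \<open>The lower bound\<close>

lemma power2_growth: "1 \<le> d \<Longrightarrow> d + 2 ^ Suc w < 2 ^ (w + d) + (2::nat)"
proof (induction d rule: nat_induct_at_least)
  case (Suc d)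
  have "(1::nat) \<le> 2 ^ (w + d)" "(2::nat) ^ (w + Suc d) = 2 * 2 ^ (w + d)"
    by simp_all
  with Suc show ?case
    by linarith
qed simp

text \<open>
  Evenness improves the strict inequality by one candy. The bound would not propagate through
  moves with \<open>d = 1\<close> without it.
\<close>

lemma candies_le_if_P:
  assumes "P_position H" "candies H < 2 ^ Suc w"
  shows "candies H + 2 \<le> 2 ^ Suc w"
  using assms even_candies_if_P [OF assms(1)] by (auto elim!: evenE)

lemma candies_le_after_move_from_P:
  assumes "P_position G" "(c, K) \<in> moves G"
  shows "candies G \<le> 2 * candies K"
proof -
  obtain x R where *: "G = add_mset x R" "K = add_mset (x - c) R" "0 < c" "c \<le> x"
    using assms by (auto simp: moves_iff)
  then show ?thesis
    using pile_le_half_if_P [of x R] assms(1) by simp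
qed

text \<open>
  The two claims are proved together: the bound for an \<open>N\<close> position comes from any winning move
  into a smaller \<open>P\<close> position, and the bound for a \<open>P\<close> position from the one for the \<open>N\<close> position
  that Luca's optimal move leaves, which still holds at least half of the candies.
\<close>

lemma candies_less_power_windsor:
  "candies G < 2 ^ Suc (windsor_candies G) \<and>
   (\<not> P_position G \<longrightarrow> candies G < 2 ^ windsor_candies G)"
proof (induction "candies G" arbitrary: G rule: less_induct)
  case less
  have N: "candies K < 2 ^ windsor_candies K"
    if K: "\<not> P_position K" "candies K \<le> candies G" for K
  proof -
    obtain d H where dH: "(d, H) \<in> winning_moves K"
      using winning_moves_nonempty [OF K(1)] by auto
    note D = winning_moveD [OF dH]
    have "candies H < 2 ^ Suc (windsor_candies H)"
      using less D K by simp
    then have "candies K + 2 \<le> d + 2 ^ Suc (windsor_candies H)"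
      using candies_le_if_P [OF D(1)] D(3) by simp
    also have "\<dots> < 2 ^ (windsor_candies H + d) + 2"
      using power2_growth D by simp
    finally have "candies K < 2 ^ (windsor_candies H + d)"
      by simp
    also have "\<dots> \<le> 2 ^ windsor_candies K"
      using windsor_candies_ge_if_winning_move [OF K(1) dH] by (intro power_increasing) simp_all
    finally show ?thesis .
  qed
  show ?case
  proof (cases "P_position G")
    case False
    with N [of G] show ?thesis
      by simp
  next
    case True
    show ?thesis
    proof (cases "candies G = 0")
      case False
      then obtain c K where cK: "(c, K) \<in> moves G" "windsor_candies G = windsor_candies K"
        using True optimal_move_exists by auto
      have "candies K < 2 ^ windsor_candies K"
        using N not_P_if_move_from_P [OF True cK(1)] candies_move [OF cK(1)] by simp
      then show ?thesis
        using True cK(2) candies_le_after_move_from_P [OF True cK(1)] by simp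
    qed (use True in simp)
  qed
qed

lemma floor_log_eq_iff:
  assumes "0 < (N::nat)"
  shows "\<lfloor>log 2 (real N)\<rfloor> = int w \<longleftrightarrow> 2 ^ w \<le> N \<and> N < 2 ^ Suc w"
  using floor_log_nat_eq_powr_iff [of 2 N w] assms by auto


section \<open>The extremal arrangements\<close>

abbreviation powers :: "nat \<Rightarrow> position" where
  "powers n \<equiv> image_mset (\<lambda>i. 2 ^ i) (mset_set {i. i < n})"

lemma powers_Suc: "powers (Suc n) = add_mset (2 ^ n) (powers n)"
proof -
  have "{i. i < Suc n} = insert n {i. i < n}"
    by auto
  then show ?thesis
    by simp
qed

lemma in_powers_iff: "x \<in># powers n \<longleftrightarrow> (\<exists>i<n. x = 2 ^ i)"
  by auto

lemma powers_Suc_remove: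
  assumes "p < n"
  shows "powers (Suc n) - {#2 ^ p#} = add_mset (2 ^ n) (powers n - {#2 ^ p#})"
proof -
  have "2 ^ p \<in># powers n"
    using assms by auto
  then obtain Q where "powers n = add_mset (2 ^ p) Q"
    by (blast dest: multi_member_split)
  then show ?thesis
    unfolding powers_Suc by (simp only: add_mset_commute [of "2 ^ n"] add_mset_remove_trivial)
qed

lemma candies_powers: "candies (powers n) = 2 ^ n - 1"
proof (induction n)
  case (Suc n)
  then show ?case
    unfolding powers_Suc candies_add_mset by simp
qed simp

lemma nim_sum_powers: "nim_sum (powers n) = 2 ^ n - 1"
proof (induction n)
  case (Suc n)
  then show ?case
    unfolding powers_Suc nim_sum_add_mset by (metis top_power_xor_mask)
qed simp

lemma powers_pos: "{#a \<in># powers n. a > 0#} = powers n"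
  by (rule filter_mset_eq_conv [THEN iffD2]) auto

lemma arrangement1_Suc: "arrangement1 (Suc m) = add_mset 1 (add_mset 1 (add_mset (2 ^ m - 1) (powers m)))"
  by (simp add: arrangement1_def)

lemma arrangement2_Suc: "arrangement2 (Suc m) = add_mset (2 ^ m - 1) (powers m)"
  by (simp add: arrangement2_def)

lemma arrangement3_Suc:
  assumes "p < m"
  shows "arrangement3 (Suc m) (Suc p) = add_mset (2 ^ m - 1 - 2 ^ p) (powers m - {#2 ^ p#})"
proof -
  have "{i. i < m} = insert p {i. i < m \<and> i \<noteq> p}"
    using assms by auto
  moreover have "mset_set (insert p {i. i < m \<and> i \<noteq> p}) = add_mset p (mset_set {i. i < m \<and> i \<noteq> p})"
    by (rule mset_set.insert) simp_all
  ultimately have "mset_set {i. i < m} = add_mset p (mset_set {i. i < m \<and> i \<noteq> p})"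
    by (simp only:)
  then show ?thesis
    by (simp add: arrangement3_def)
qed

lemma candies_arrangement1:
  assumes "0 < n"
  shows "candies (arrangement1 n) = 2 ^ n"
proof -
  obtain m where "n = Suc m"
    using assms gr0_implies_Suc by blast
  moreover have "(1::nat) \<le> 2 ^ m"
    by simp
  ultimately show ?thesis
    by (simp only: arrangement1_Suc candies_add_mset candies_powers power_Suc)
qed

lemma candies_arrangement2: "0 < n \<Longrightarrow> candies (arrangement2 n) = 2 ^ n - 2"
  by (cases n) (simp_all add: arrangement2_Suc candies_powers)

lemma candies_arrangement3:
  assumes "0 < k" "k + 1 < n"
  shows "candies (arrangement3 n k) = 2 ^ n - 2 ^ k - 2"
proof -
  obtain m p where *: "n = Suc m" "k = Suc p"
    using assms by (metis gr0_implies_Suc less_nat_zero_code not_gr_zero)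
  with assms have "p < m"
    by simp
  then have "2 ^ p \<in># powers m" "(2::nat) ^ Suc p \<le> 2 ^ m"
    unfolding in_powers_iff by (blast, intro power_increasing) simp_all
  then have "powers m = add_mset (2 ^ p) (powers m - {#2 ^ p#})"
    by simp
  then have "2 ^ p + candies (powers m - {#2 ^ p#}) = 2 ^ m - 1"
    by (metis candies_add_mset candies_powers)
  then show ?thesis
    using \<open>(2::nat) ^ Suc p \<le> 2 ^ m\<close> by (simp add: * arrangement3_Suc [OF \<open>p < m\<close>])
qed

section \<open>The arrangements attain the bound\<close>

text \<open>
  Luca reduces the pile \<open>2 ^ (j + 1) - 1 - a'\<close> to \<open>a'\<close>. The nim-sum becomes
  \<open>2 ^ (j + 1) - 1\<close>, so Windsor's move must complement a pile in its \<open>j + 1\<close> lowest bits. This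
  makes every pile below \<open>2 ^ j\<close> larger, hence his only winning move is
  \<open>2 ^ j \<mapsto> 2 ^ j - 1\<close>, worth one candy. The choice \<open>a' = 0\<close> serves the first two families and
  \<open>a' = 2 ^ p\<close> the third.
\<close>

lemma windsor_candies_descent:
  assumes "\<And>x. x \<in># add_mset a' R \<Longrightarrow> x < 2 ^ j" "nim_sum (add_mset a' R) = 2 ^ j - 1"
  shows "windsor_candies (add_mset (2 ^ Suc j - 1 - a') (add_mset (2 ^ j) R))
    \<le> Suc (windsor_candies (add_mset (2 ^ j - 1) (add_mset a' R)))"
proof -
  let ?G = "add_mset (2 ^ Suc j - 1 - a') (add_mset (2 ^ j) R)"
  let ?K = "add_mset (2 ^ j) (add_mset a' R)"
  have a': "a' < 2 ^ j"
    using assms(1) by simp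
  have s: "nim_sum ?K = 2 ^ Suc j - 1"
    using assms(2) top_power_xor_mask by simp
  have a: "2 ^ Suc j - 1 - a' = a' XOR (2 ^ Suc j - 1)"
    using a' by (subst xor_mask_eq) simp_all
  have "nim_sum ?G = (2 ^ Suc j - 1) XOR nim_sum ?K"
    unfolding a by (simp add: ac_simps del: power_Suc)
  then have P: "P_position ?G"
    unfolding s P_position_def by simp
  have "(2 ^ Suc j - 1 - 2 * a', ?K) \<in> moves ?G"
    unfolding moves_iff using a'
    by (intro exI [of _ "2 ^ Suc j - 1 - a'"] exI [of _ "add_mset (2 ^ j) R"])
      (auto simp: add_mset_commute)
  with P show ?thesis
  proof (rule windsor_candies_P_leI)
    fix d H
    assume "(d, H) \<in> winning_moves ?K"
    then obtain x R' where *: "?K = add_mset x R'" "H = add_mset (x XOR nim_sum ?K) R'"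
      "x XOR nim_sum ?K < x" "d = x - (x XOR nim_sum ?K)"
      unfolding winning_moves_iff by blast
    have "x \<in># ?K"
      by (simp add: *(1))
    then have x: "x < 2 ^ j \<or> x = 2 ^ j"
      using assms(1) by auto
    then have xs: "x XOR nim_sum ?K = 2 ^ Suc j - 1 - x"
      unfolding s by (intro xor_mask_eq) auto
    with *(3) x have "x = 2 ^ j"
      by auto
    with * xs show "d + windsor_candies H \<le> Suc (windsor_candies (add_mset (2 ^ j - 1) (add_mset a' R)))"
      by simp
  qed
qed

lemma windsor_candies_arrangement2: "windsor_candies (arrangement2 (Suc m)) \<le> m"
proof (induction m)
  case 0
  show ?case
    by (simp add: arrangement2_Suc windsor_candies_0)
next
  case (Suc m)
  have "arrangement2 (Suc (Suc m)) = add_mset (2 ^ Suc m - 1 - 0) (add_mset (2 ^ m) (powers m))"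
    by (simp add: arrangement2_Suc powers_Suc)
  also have "windsor_candies \<dots> \<le> Suc (windsor_candies (add_mset (2 ^ m - 1) (add_mset 0 (powers m))))"
    by (rule windsor_candies_descent) (auto simp: nim_sum_powers)
  also have "add_mset (2 ^ m - 1) (add_mset 0 (powers m)) = add_mset 0 (arrangement2 (Suc m))"
    by (simp add: arrangement2_Suc add_mset_commute)
  finally show ?case
    using Suc by (simp add: windsor_candies_add_empty_pile)
qed

lemma windsor_candies_arrangement3:
  assumes "p < m"
  shows "windsor_candies (arrangement3 (Suc (Suc m)) (Suc p)) \<le> Suc m"
proof -
  have p: "2 ^ p \<in># powers m"
    using assms by auto
  have pw: "add_mset (2 ^ p) (powers m - {#2 ^ p#}) = powers m"
    using p by simp
  have "arrangement3 (Suc (Suc m)) (Suc p)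
      = add_mset (2 ^ Suc m - 1 - 2 ^ p) (add_mset (2 ^ m) (powers m - {#2 ^ p#}))"
    using assms by (subst arrangement3_Suc) (simp_all only: powers_Suc_remove less_SucI)
  also have "windsor_candies \<dots>
      \<le> Suc (windsor_candies (add_mset (2 ^ m - 1) (add_mset (2 ^ p) (powers m - {#2 ^ p#}))))"
    by (rule windsor_candies_descent; unfold pw) (auto simp: nim_sum_powers)
  also have "\<dots> = Suc (windsor_candies (arrangement2 (Suc m)))"
    unfolding pw arrangement2_Suc ..
  finally show ?thesis
    using windsor_candies_arrangement2 [of m] by simp
qed

text \<open>
  The descent would need \<open>j = 0\<close> here, but the other piles of size \<open>1\<close> are not below \<open>2 ^ 0\<close>. Windsor has three winning replies, but they leave the same position.
\<close>

lemma windsor_candies_four_ones: "windsor_candies {#1, 1, 1, 1#} \<le> 2"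
proof (rule windsor_candies_P_leI)
  show "P_position {#1, 1, 1, 1#}"
    by (simp add: P_position_def)
  show "(1, {#0, 1, 1, 1#}) \<in> moves {#1, 1, 1, 1#}"
    unfolding moves_iff by (intro exI [of _ 1] exI [of _ "{#1, 1, 1#}"]) simp
next
  fix d H
  assume "(d, H) \<in> winning_moves {#0, 1, 1, 1#}"
  then obtain x R where *: "{#0, 1, 1, 1#} = add_mset x R" "H = add_mset (x XOR 1) R"
    "x XOR 1 < x" "d = x - (x XOR 1)"
    unfolding winning_moves_iff by auto
  have "x \<in># {#0, 1, 1, 1#}"
    unfolding *(1) by simp
  then have "x = 0 \<or> x = 1"
    by auto
  with *(3) have x: "x = 1"
    by auto
  then have "R = {#0, 1, 1#}"
    using *(1) by (auto simp: add_mset_commute [of 0 1])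
  then have H: "H = add_mset 0 (add_mset 0 (arrangement2 (Suc (Suc 0))))"
    using *(2) x by (simp add: arrangement2_Suc powers_Suc)
  have "windsor_candies H \<le> 1"
    unfolding H windsor_candies_add_empty_pile using windsor_candies_arrangement2 [of "Suc 0"] by simp
  then show "d + windsor_candies H \<le> 2"
    using *(4) x by simp
qed

lemma windsor_candies_arrangement1: "windsor_candies (arrangement1 (Suc m)) \<le> Suc m"
proof (induction m)
  case 0
  have "arrangement1 (Suc 0) = add_mset 0 (arrangement2 (Suc (Suc 0)))"
    by (simp add: arrangement1_Suc arrangement2_Suc powers_Suc add_mset_commute)
  then show ?case
    using windsor_candies_arrangement2 [of "Suc 0"] by (simp add: windsor_candies_add_empty_pile)
next
  case (Suc m)
  show ?case
  proof (cases "m = 0")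
    case True
    have "arrangement1 (Suc (Suc 0)) = {#1, 1, 1, 1#}"
      by (simp add: arrangement1_Suc powers_Suc)
    then show ?thesis
      using windsor_candies_four_ones True by simp
  next
    case False
    let ?R = "add_mset 1 (add_mset 1 (powers m))"
    have "1 < (2::nat) ^ m"
      using False by (intro one_less_power) simp_all
    have "arrangement1 (Suc (Suc m)) = add_mset (2 ^ Suc m - 1 - 0) (add_mset (2 ^ m) ?R)"
      by (simp add: arrangement1_Suc powers_Suc add_mset_commute)
    also have "windsor_candies \<dots> \<le> Suc (windsor_candies (add_mset (2 ^ m - 1) (add_mset 0 ?R)))"
      using \<open>1 < 2 ^ m\<close>
      by (intro windsor_candies_descent) (auto simp: nim_sum_powers xor.assoc [symmetric])
    also have "add_mset (2 ^ m - 1) (add_mset 0 ?R) = add_mset 0 (arrangement1 (Suc m))"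
      by (simp add: arrangement1_Suc add_mset_commute)
    finally show ?thesis
      using Suc by (simp add: windsor_candies_add_empty_pile)
  qed
qed


section \<open>Only the arrangements attain the bound\<close>

text \<open>
  For \<open>0 < m\<close> these are the arrangements with \<open>\<lfloor>log\<^sub>2 N\<rfloor> = m\<close>, which is the parameter that
  drops by one in each round. The second and third family are shifted by one, because
  \<open>2 ^ n - 2\<close> and \<open>2 ^ n - 2 ^ k - 2\<close> lie between \<open>2 ^ (n - 1)\<close> and \<open>2 ^ n\<close>.
\<close>

definition extremal :: "nat \<Rightarrow> position \<Rightarrow> bool" where
  "extremal m G \<longleftrightarrow> same_position G (arrangement1 m) \<or> same_position G (arrangement2 (Suc m))
    \<or> (\<exists>k. 0 < k \<and> k < m \<and> same_position G (arrangement3 (Suc m) k))"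

lemma extremal_arrangement2_if_candies:
  assumes "extremal m G" "2 \<le> m" "candies G = 2 ^ Suc m - 2"
  shows "same_position G (arrangement2 (Suc m))"
proof -
  have m: "4 \<le> (2::nat) ^ m"
    using power_increasing [OF assms(2), of "2::nat"] by simp
  have "\<not> same_position G (arrangement1 m)"
    using candies_same_position [of G "arrangement1 m"] candies_arrangement1 [of m] assms m by auto
  moreover have "\<not> same_position G (arrangement3 (Suc m) k)" if "0 < k" "k < m" for k
  proof
    assume "same_position G (arrangement3 (Suc m) k)"
    then have "candies G = 2 ^ Suc m - 2 ^ k - 2"
      using candies_same_position candies_arrangement3 that by simp
    moreover have "(1::nat) \<le> 2 ^ k"
      by simp
    moreover have "4 \<le> (2::nat) ^ Suc m"
      using m by simp
    ultimately show False
      using assms(3) by linarith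
  qed
  ultimately show ?thesis
    using assms(1) unfolding extremal_def by blast
qed

lemma count_same_position: "same_position G H \<Longrightarrow> 0 < x \<Longrightarrow> count G x = count H x"
  by (metis same_position_def count_filter_mset)

lemma pile_same_position: "same_position G H \<Longrightarrow> x \<in># G \<Longrightarrow> 0 < x \<Longrightarrow> x \<in># H"
  by (metis count_same_position not_in_iff)

lemma same_position_sym: "same_position G H \<Longrightarrow> same_position H G"
  by (simp add: same_position_def)

text \<open>
  In this and the following lemmas Luca moves \<open>a \<mapsto> a'\<close>, Windsor replies \<open>b' + 1 \<mapsto> b'\<close>, and \<open>R\<close>
  is the rest of the position. Here the number of candies must double, so Luca takes at
  least \<open>2 ^ m - 1\<close> of them, and \<open>2 ^ (m - 1)\<close> divides \<open>b' + 1\<close>. As no pile reaches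
  \<open>2 ^ (m - 1)\<close>, the pile \<open>b'\<close> is \<open>2 ^ (m - 1) - 1\<close>, and then Luca can have taken enough only
  from a pile of size \<open>2 ^ m - 1\<close>, leaving \<open>a' = 0\<close>.
\<close>

lemma extremal_step_arrangement1:
  assumes H: "same_position (add_mset a' (add_mset b' R)) (arrangement1 m)" and m: "2 \<le> m"
    and s: "s = Suc b' XOR b'" and a: "a = a' XOR s" "a' < a"
    and N: "2 ^ Suc m \<le> candies (add_mset a (add_mset (Suc b') R))"
  shows "same_position (add_mset a (add_mset (Suc b') R)) (arrangement1 (Suc m))"
proof -
  obtain m' where m': "m = Suc m'" "1 \<le> m'"
    using m by (cases m) auto
  have m'2: "(2::nat) \<le> 2 ^ m'"
    using power_increasing [OF m'(2), of "2::nat"] by simp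
  have small: "x < 2 ^ m'" if "x \<in># add_mset a' (add_mset b' R)" for x
  proof (cases "x = 0")
    case False
    with pile_same_position [OF H that] have "x \<in># arrangement1 m"
      by simp
    then show ?thesis
      using m'2 by (auto simp: m'(1) arrangement1_Suc)
  qed simp
  have "a' + b' + candies R = 2 ^ m"
    using candies_same_position [OF H] candies_arrangement1 [of m] m by simp
  then have gain: "2 ^ m + a' \<le> a + 1"
    using N by simp
  moreover have "a \<le> a' + s"
    unfolding a using xor_le_add by simp
  ultimately have "2 ^ m \<le> s + 1"
    by simp
  then have "2 ^ m' \<le> Suc b' XOR b'"
    using m'2 s by (simp add: m'(1))
  then have "2 ^ m' dvd Suc b'"
    by (rule power_dvd_if_le_xor_Suc)
  then have "2 ^ m' \<le> Suc b'"
    by (rule dvd_imp_le) simp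
  then have b': "b' = 2 ^ m' - 1" "Suc b' = 2 ^ m'"
    using small [of b'] by auto
  have s': "s = 2 ^ m - 1"
    unfolding s b'(2) unfolding b'(1) top_power_xor_mask m'(1) ..
  have "a' < 2 ^ m"
    using small [of a'] m'(1) by simp
  then have "a = 2 ^ m - 1 - a'"
    unfolding a s' by (rule xor_mask_eq)
  with gain \<open>a' < 2 ^ m\<close> have "a' = 0"
    by linarith
  with \<open>a = 2 ^ m - 1 - a'\<close> have a'0: "a' = 0" "a = 2 ^ m - 1"
    by simp_all
  have "{#x \<in># R. x > 0#} = add_mset 1 (add_mset 1 (powers m'))"
    using H m'2 unfolding same_position_def m'(1) arrangement1_Suc
    by (simp add: a'0 b'(1) powers_pos add_mset_commute)
  moreover have "0 < a"
    using a by simp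
  ultimately show ?thesis
    using m'2 a'0(2) unfolding same_position_def arrangement1_Suc b'(2)
    by (simp add: powers_pos powers_Suc m'(1) add_mset_commute)
qed

text \<open>
  A third-family position is \<open>2 ^ (p + 1) + 2\<close> candies short of \<open>2 ^ (m + 1)\<close>. Luca's gain must
  make up for this, so
  \<open>2 ^ (p + 1)\<close> divides \<open>b' + 1\<close>. No pile allows this: the large one has bit \<open>p\<close> unset, and a
  power of two could only be \<open>1\<close> with \<open>p = 0\<close>, which is the power that is missing.
\<close>

lemma no_extremal_step_arrangement3:
  assumes H: "same_position (add_mset a' (add_mset b' R)) (arrangement3 (Suc m) (Suc p))" and m: "Suc p < m"
    and s: "s = Suc b' XOR b'" and a: "a = a' XOR s" "a' < a"
    and N: "2 ^ Suc m \<le> candies (add_mset a (add_mset (Suc b') R))"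
  shows False
proof -
  have pm: "(2::nat) ^ Suc (Suc p) \<le> 2 ^ m"
    using m by (intro power_increasing) simp_all
  have "a' + b' + candies R = 2 ^ Suc m - 2 ^ Suc p - 2"
    using candies_same_position [OF H] candies_arrangement3 [of "Suc p" "Suc m"] m by simp
  moreover have "2 ^ Suc m \<le> a + (Suc b' + candies R)"
    using N by simp
  moreover have "(2::nat) ^ Suc m = 2 * 2 ^ m" "(2::nat) ^ Suc (Suc p) = 2 * 2 ^ Suc p" "1 \<le> (2::nat) ^ Suc p"
    by simp_all
  ultimately have "2 ^ Suc p + 2 + a' \<le> a + 1"
    using pm by linarith
  moreover have "a \<le> a' + s"
    unfolding a using xor_le_add by simp
  ultimately have "2 ^ Suc p \<le> Suc b' XOR b'"
    using s by simp
  then have dvd: "2 ^ Suc p dvd Suc b'"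
    by (rule power_dvd_if_le_xor_Suc)
  then have even: "even (Suc b')"
    using dvd_mult_left [of 2 "2 ^ p" "Suc b'"] by simp
  then have "0 < b'"
    by (cases b') auto
  with pile_same_position [OF H, of b'] have "b' \<in># arrangement3 (Suc m) (Suc p)"
    by simp
  then consider "b' = 2 ^ m - 1 - 2 ^ p" | "b' \<in># powers m - {#2 ^ p#}"
    using m by (auto simp: arrangement3_Suc)
  then show False
  proof cases
    case 1
    then have "Suc b' + 2 ^ p = 2 ^ m"
      using pm one_le_power [of "2::nat" p] unfolding power_Suc by linarith
    moreover have "(2::nat) ^ Suc p dvd 2 ^ m"
      using m by (intro le_imp_power_dvd) simp
    ultimately have "(2::nat) ^ Suc p dvd 2 ^ p"
      using dvd by (metis dvd_add_right_iff)
    then show False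
      by (auto dest: power_dvd_imp_le)
  next
    case 2
    then obtain i where "b' = 2 ^ i"
      using in_diffD in_powers_iff by metis
    with even have b': "b' = 1"
      by (cases i) auto
    with dvd have "2 ^ Suc p dvd (2::nat) ^ 1"
      by (simp only: Suc_1 power_one_right)
    then have "p = 0"
      using power_dvd_imp_le [of 2 "Suc p" 1] by simp
    with 2 b' have "count (powers m) 1 \<ge> 2"
      by (simp add: in_diff_count)
    moreover have "count (powers m) 1 \<le> 1"
    proof (induction m)
      case (Suc m)
      then show ?case
        by (cases m) (auto simp: powers_Suc simp del: image_mset_mset_set)
    qed simp
    ultimately show False
      by simp
  qed
qed


text \<open>
  The nim-sum after Luca's move is \<open>2 ^ (m + 1) - 1\<close>, so \<open>a\<close> is the complement of \<open>a'\<close>. An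
  empty pile \<open>a'\<close> continues the second family, a power of two \<open>a'\<close> gives a member of the third.
\<close>

lemma extremal_step_arrangement2_top:
  assumes H: "same_position (add_mset a' (add_mset (2 ^ m - 1) R)) (arrangement2 (Suc m))" and m: "1 \<le> m"
    and a: "a = a' XOR (2 ^ m XOR (2 ^ m - 1))"
  shows "extremal (Suc m) (add_mset a (add_mset (2 ^ m) R))"
proof -
  have m2: "2 \<le> (2::nat) ^ m"
    using power_increasing [OF m, of "2::nat"] by simp
  have R: "{#x \<in># add_mset a' R. x > 0#} = powers m"
  proof -
    define T :: nat where "T = 2 ^ m - 1"
    have "0 < T"
      using m2 by (simp add: T_def)
    with H show ?thesis
      unfolding same_position_def arrangement2_Suc T_def [symmetric] add_mset_commute [of a' T]
      by (simp add: powers_pos)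
  qed
  have a's: "a' = 0 \<or> a' \<in># powers m"
    unfolding R [symmetric] by auto
  moreover have "(2::nat) ^ i < 2 ^ Suc m" if "i < m" for i
    using that by (intro power_strict_increasing) simp_all
  ultimately have "a' < 2 ^ Suc m"
    by (auto simp: in_powers_iff)
  then have a_eq: "a = 2 ^ Suc m - 1 - a'"
    unfolding a top_power_xor_mask by (rule xor_mask_eq)
  show ?thesis
  proof (cases "a' = 0")
    case True
    with R have "{#x \<in># R. x > 0#} = powers m"
      by simp
    then have "same_position (add_mset a (add_mset (2 ^ m) R)) (arrangement2 (Suc (Suc m)))"
      using m2 True a_eq unfolding same_position_def arrangement2_Suc powers_Suc
      by (simp add: powers_pos)
    then show ?thesis
      by (simp add: extremal_def)
  next
    case False
    with a's obtain p where p: "p < m" "a' = 2 ^ p"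
      by auto
    have pw: "powers (Suc m) - {#2 ^ p#} = add_mset (2 ^ m) (powers m - {#2 ^ p#})"
      using p(1) by (rule powers_Suc_remove)
    have pm: "(2::nat) ^ Suc p \<le> 2 ^ m"
      using p by (intro power_increasing) simp_all
    have "{#x \<in># R. x > 0#} = powers m - {#2 ^ p#}"
      using R p by (metis add_mset_remove_trivial filter_mset_add_mset zero_less_numeral zero_less_power)
    then have "same_position (add_mset a (add_mset (2 ^ m) R)) (arrangement3 (Suc (Suc m)) (Suc p))"
      using pm a_eq p unfolding same_position_def
      by (simp add: arrangement3_Suc pw powers_pos del: filter_mset_eq_conv)
    then show ?thesis
      using p unfolding extremal_def by blast
  qed
qed

text \<open>
  This is where the first family branches off from \<open>[1,1]\<close>, by adding a candy to two empty piles.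
\<close>

lemma extremal_step_arrangement2_ones:
  assumes H: "same_position (add_mset a' (add_mset 0 R)) (arrangement2 2)"
    and a: "a = a' XOR 1" "a' < a"
  shows "same_position (add_mset a (add_mset 1 R)) (arrangement1 2)"
proof -
  have ar: "arrangement2 2 = {#1, 1#}" "arrangement1 2 = {#1, 1, 1, 1#}"
    using arrangement2_Suc [of 1] arrangement1_Suc [of 1] powers_Suc [of 0]
    by (simp_all add: numeral_2_eq_2)
  have "a' = 0"
  proof (rule ccontr)
    assume "a' \<noteq> 0"
    with pile_same_position [OF H, of a'] have "a' = 1"
      unfolding ar by simp
    with a show False
      by simp
  qed
  with H a show ?thesis
    unfolding same_position_def ar by simp
qed

text \<open>
  Let Windsor's reply avoid the largest pile \<open>T = 2 ^ m - 1\<close>. If \<open>b' = 1\<close>, the nim-sum before the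
  reply is \<open>3\<close> and Windsor could have taken three candies from \<open>T\<close>, not just one. Otherwise the nim-sum is \<open>1\<close>,
  and Windsor could have taken one candy from any odd pile \<open>x\<close>. Each such reply must
  lead to the second family again, by the number of candies; then the number of piles of
  size \<open>x\<close> is the same as after the actual reply, which forces \<open>x = b' + 1\<close>. But \<open>1\<close> and \<open>T\<close>
  are two different choices of \<open>x\<close>.
\<close>

lemma no_extremal_step_arrangement2_other:
  assumes H: "same_position (add_mset a' (add_mset b' R)) (arrangement2 (Suc m))" and m: "2 \<le> m"
    and P: "P_position (add_mset a' (add_mset b' R))"
    and b': "b' = 0 \<or> b' \<in># powers m"
    and replies: "\<And>d H'. (d, H') \<in> winning_moves (add_mset a' (add_mset (Suc b') R)) \<Longrightarrow>
      d = 1 \<and> extremal m H'"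
  shows False
proof -
  let ?H = "add_mset a' (add_mset b' R)"
  let ?K = "add_mset a' (add_mset (Suc b') R)"
  let ?T = "2 ^ m - 1 :: nat"
  have m2: "4 \<le> (2::nat) ^ m"
    using power_increasing [OF m, of "2::nat"] by simp
  have oddT: "odd ?T"
    using m by simp
  have "nim_sum ?K = (Suc b' XOR b') XOR nim_sum ?H"
    by (simp add: ac_simps xor_left_self)
  then have s: "nim_sum ?K = Suc b' XOR b'"
    using P by (simp add: P_position_def)
  have "1 \<in># powers m"
    unfolding in_powers_iff using m by (intro exI [of _ 0]) simp
  then have 1: "1 \<in># ?H" and T: "?T \<in># ?H"
    using pile_same_position [OF same_position_sym [OF H]] m2 by (auto simp: arrangement2_Suc)
  have K: "x \<in># ?K" if "x \<in># ?H" "x \<noteq> b'" for x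
    using that by auto
  have b'T: "b' \<noteq> ?T"
  proof
    assume *: "b' = ?T"
    with b' m2 obtain i where i: "b' = 2 ^ i"
      unfolding in_powers_iff by auto
    have "odd b'"
      using oddT unfolding * .
    with i have "i = 0"
      by (cases i) auto
    with i * m2 show False
      by simp
  qed
  have "b' \<noteq> 1"
  proof
    assume "b' = 1"
    moreover have "(2::nat) XOR 1 = 3"
      by simp
    ultimately have s3: "nim_sum ?K = 3"
      using s by (simp only: Suc_1)
    have T3: "?T XOR nim_sum ?K = ?T - 3"
      unfolding s3 using xor_mask_eq [of 3 m] m2 by (simp add: xor.commute)
    then have "(?T - (?T - 3), add_mset (?T - 3) (?K - {#?T#})) \<in> winning_moves ?K"
      using winning_moveI [of ?T ?K] K [OF T] b'T m2 by simp
    then have "?T - (?T - 3) = 1"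
      using replies by blast
    then show False
      using m2 by simp
  qed
  with b' have even: "even b'"
    by (auto simp: in_powers_iff)
  then have "Suc b' = b' XOR 1"
    by (simp add: xor_Suc_0_eq)
  then have s1: "nim_sum ?K = 1"
    unfolding s by (simp add: xor.commute [of _ b'] xor_left_self)
  have "Suc b' = x" if x: "x \<in># ?H" "odd x" for x
  proof -
    have xb': "x \<noteq> b'"
      using even x by auto
    have xs: "x XOR nim_sum ?K = x - 1" and "0 < x"
      unfolding s1 using x by (simp_all add: xor_Suc_0_eq odd_pos)
    let ?H' = "add_mset (x - 1) (?K - {#x#})"
    have reply: "(x - (x - 1), ?H') \<in> winning_moves ?K"
      using winning_moveI [of x ?K] K [OF x(1) xb'] \<open>0 < x\<close> unfolding xs by simp
    then have ext: "extremal m ?H'"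
      using replies by blast
    have "candies ?K = (x - (x - 1)) + candies ?H'"
      using winning_moveD(3) [OF reply] .
    then have "candies ?H' = candies ?H"
      using \<open>0 < x\<close> by simp
    then have "candies ?H' = 2 ^ Suc m - 2"
      using candies_same_position [OF H] candies_arrangement2 [of "Suc m"] by simp
    from extremal_arrangement2_if_candies [OF ext m this]
    have "count ?H' x = count ?H x"
      unfolding count_same_position [OF H \<open>0 < x\<close>] using \<open>0 < x\<close> by (rule count_same_position)
    moreover have "count ?H' x = count ?K x - 1"
      using \<open>0 < x\<close> by simp
    moreover have "0 < count ?K x"
      using K [OF x(1) xb'] by (simp only: count_greater_zero_iff)
    ultimately have "count ?K x = Suc (count ?H x)"
      by linarith
    then show ?thesis
      using xb' by (simp split: if_splits)
  qed
  from this [OF 1] this [OF T oddT] m2 show False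
    by simp
qed

text \<open>
  One round of play, read backwards. For \<open>m = 1\<close> the first two families have the same
  member \<open>[1,1]\<close>, which is treated as one of the second family.
\<close>

lemma extremal_step:
  assumes m: "1 \<le> m" and ext: "extremal m (add_mset a' (add_mset b' R))"
    and P: "P_position (add_mset a' (add_mset b' R))"
    and s: "s = Suc b' XOR b'" and a: "a = a' XOR s" "a' < a"
    and N: "2 ^ Suc m \<le> candies (add_mset a (add_mset (Suc b') R))"
    and replies: "\<And>d H'. (d, H') \<in> winning_moves (add_mset a' (add_mset (Suc b') R)) \<Longrightarrow>
      d = 1 \<and> extremal m H'"
  shows "extremal (Suc m) (add_mset a (add_mset (Suc b') R))"
proof -
  let ?H = "add_mset a' (add_mset b' R)"
  let ?G = "add_mset a (add_mset (Suc b') R)"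
  have arr2: ?thesis if H: "same_position ?H (arrangement2 (Suc m))"
  proof (cases "b' = 2 ^ m - 1")
    case True
    then have "Suc b' = 2 ^ m"
      by simp
    then show ?thesis
      using extremal_step_arrangement2_top [of a' m R a] H m a s True by simp
  next
    case False
    have b': "b' = 0 \<or> b' \<in># powers m"
      using pile_same_position [OF H, of b'] False unfolding arrangement2_Suc by auto
    show ?thesis
    proof (cases "m = 1")
      case True
      with b' False have "b' = 0"
        by auto
      then show ?thesis
        using extremal_step_arrangement2_ones [of a' R a] H a s True by (simp add: extremal_def numeral_2_eq_2)
    next
      case False
      then show ?thesis
        using no_extremal_step_arrangement2_other [OF H _ P b' replies] m by simp
    qed
  qed
  from ext consider "same_position ?H (arrangement1 m)" | "same_position ?H (arrangement2 (Suc m))"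
    | k where "0 < k" "k < m" "same_position ?H (arrangement3 (Suc m) k)"
    unfolding extremal_def by blast
  then show ?thesis
  proof cases
    case 1
    show ?thesis
    proof (cases "m = 1")
      case True
      have "same_position (arrangement1 1) (arrangement2 2)"
        using arrangement2_Suc [of 1] arrangement1_Suc [of 0] powers_Suc [of 0]
        by (simp add: numeral_2_eq_2 same_position_def)
      with 1 True have "same_position ?H (arrangement2 (Suc m))"
        by (simp add: same_position_def numeral_2_eq_2)
      then show ?thesis
        by (rule arr2)
    next
      case False
      then show ?thesis
        using extremal_step_arrangement1 [OF 1 _ s a N] m by (simp add: extremal_def)
    qed
  next
    case 2
    then show ?thesis
      by (rule arr2)
  next
    case 3
    then obtain p where "k = Suc p"
      using gr0_implies_Suc by blast
    with 3 show ?thesis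
      using no_extremal_step_arrangement3 [of a' b' R m p s a] s a N by blast
  qed
qed


lemma power2_growth_from_3: "3 \<le> d \<Longrightarrow> 2 * d + 2 ^ (w + 2) < 2 ^ (w + d) + (4::nat)"
proof (induction d rule: nat_induct_at_least)
  case (Suc d)
  have "(2::nat) ^ 1 \<le> 2 ^ (w + d)"
    using Suc.hyps by (intro power_increasing) simp_all
  moreover have "(2::nat) ^ (w + Suc d) = 2 * 2 ^ (w + d)"
    by simp
  ultimately show ?case
    using Suc.IH by simp
next
  case base
  have "(2::nat) ^ (w + 2) = 4 * 2 ^ w" "(2::nat) ^ (w + 3) = 8 * 2 ^ w" "(1::nat) \<le> 2 ^ w"
    by (simp_all add: power_add)
  then show ?case
    by linarith
qed

lemma extremal_one_one:
  assumes "candies Z = 0"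
  shows "extremal 1 (add_mset 1 (add_mset 1 Z))"
proof -
  have "{#x \<in># Z. x > 0#} = {#}"
    using assms by (auto simp: candies_def filter_mset_eq_conv)
  moreover have "arrangement2 2 = {#1, 1#}"
    using arrangement2_Suc [of 1] powers_Suc [of 0] by (simp add: numeral_2_eq_2)
  ultimately show ?thesis
    by (simp add: extremal_def same_position_def numeral_2_eq_2)
qed

lemma extremal_two_two:
  assumes "candies Z = 0"
  shows "extremal 2 (add_mset 2 (add_mset 2 Z))"
proof -
  have "{#x \<in># Z. x > 0#} = {#}"
    using assms by (auto simp: candies_def filter_mset_eq_conv)
  moreover have "arrangement3 (Suc 2) (Suc 0) = {#2, 2#}"
    using arrangement3_Suc [of 0 2] powers_Suc [of 0] powers_Suc [of 1]
    by (simp add: numeral_2_eq_2)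
  ultimately have "same_position (add_mset 2 (add_mset 2 Z)) (arrangement3 (Suc 2) (Suc 0))"
    by (simp add: same_position_def)
  then show ?thesis
    unfolding extremal_def by auto
qed

text \<open>
  Windsor's reply cannot be on the pile that Luca has just reduced: there, only restoring the
  pile would make the nim-sum zero.
\<close>

lemma reply_decomposition:
  assumes P: "P_position G" and cK: "(c, K) \<in> moves G" and dH: "(1, H) \<in> winning_moves K"
  obtains a a' b' R where "G = add_mset a (add_mset (Suc b') R)"
    "K = add_mset a' (add_mset (Suc b') R)" "H = add_mset a' (add_mset b' R)"
    "a = a' XOR (Suc b' XOR b')" "a' < a"
proof -
  obtain a S where G: "G = add_mset a S" "K = add_mset (a - c) S" "0 < c" "c \<le> a"
    using cK by (auto simp: moves_iff)
  obtain b S' where H: "K = add_mset b S'" "H = add_mset (b XOR nim_sum K) S'"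
    "b XOR nim_sum K < b" "1 = b - (b XOR nim_sum K)"
    using dH unfolding winning_moves_iff by blast
  define b' where "b' = b XOR nim_sum K"
  have b: "b = Suc b'"
    using H unfolding b'_def by simp
  have s: "nim_sum K = Suc b' XOR b'"
    unfolding b [symmetric] unfolding b'_def by (simp add: xor_left_self)
  have nimS: "nim_sum S = a"
    using P unfolding G by (rule nim_sum_eq_if_P_add_mset)
  have nimS': "nim_sum S' = b'"
    using winning_moveD(1) [OF dH] unfolding H(2) b'_def by (rule nim_sum_eq_if_P_add_mset)
  have "S \<noteq> S'"
  proof
    assume "S = S'"
    with G(2) H(1) b have "a - c = Suc b'" "a = b'"
      using nimS nimS' by auto
    then show False
      by simp
  qed
  with G(2) H(1) obtain R where R: "S = add_mset b R" "S' = add_mset (a - c) R"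
    by (auto simp: add_eq_conv_ex)
  have "a = (a - c) XOR (Suc b' XOR b')"
    unfolding s [symmetric] G(2) by (simp add: nimS xor_left_self)
  moreover have "G = add_mset a (add_mset (Suc b') R)" "K = add_mset (a - c) (add_mset (Suc b') R)"
    by (simp_all only: G R b)
  moreover have "H = add_mset (a - c) (add_mset b' R)"
    unfolding H(2) b'_def [symmetric] R(2) by (rule add_mset_commute)
  moreover have "a - c < a"
    using G by simp
  ultimately show ?thesis
    using that by blast
qed

text \<open>
  Let an optimal move of Luca leave \<open>K\<close>. Each winning reply with gain \<open>d\<close> into a position of
  share \<open>w\<close> satisfies \<open>2 ^ (w + d) \<le> N \<le> 2 * N(K) \<le> 2 * d + 2 ^ (w + 2) - 4\<close>, which excludes
  \<open>d \<ge> 3\<close> and makes all of these estimates equalities if \<open>d = 2\<close>. In that case Luca has taken a pile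
  equal to half of \<open>N\<close>, and the other half is one pile, a power of two. Windsor can take it at once;
  as no reply gains more than two, the position was \<open>[2,2]\<close>. If every reply has \<open>d = 1\<close>, then
  \<open>N(H)\<close> is the same for all replies; either it is \<open>0\<close> and the position was \<open>[1,1]\<close>, or the
  induction hypothesis applies to every reply.
\<close>

lemma extremal_if_tight:
  assumes "P_position G" "2 ^ windsor_candies G \<le> candies G"
  shows "extremal (windsor_candies G) G"
  using assms
proof (induction "candies G" arbitrary: G rule: less_induct)
  case less
  define m where "m = windsor_candies G"
  note P = less.prems(1)
  have N: "2 ^ m \<le> candies G"
    using less.prems(2) m_def by simp
  then have "0 < candies G"
    by (intro gr0I) auto
  then obtain c K where cK: "(c, K) \<in> moves G" and WK: "windsor_candies K = m"
    by (rule optimal_move_exists [OF P]) (simp add: m_def)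
  note NK = candies_le_after_move_from_P [OF P cK]
  note notP = not_P_if_move_from_P [OF P cK]
  have reply: "0 < d" "d + windsor_candies H \<le> m" "P_position H" "candies K = d + candies H"
    "candies H + 2 \<le> 2 ^ Suc (windsor_candies H)"
    if "(d, H) \<in> winning_moves K" for d H
    using windsor_candies_ge_if_winning_move [OF notP that] winning_moveD [OF that] WK
      candies_le_if_P [of H "windsor_candies H"] candies_less_power_windsor [of H] by auto
  have bound: "2 ^ (windsor_candies H + d) + 4 \<le> 2 * d + 2 ^ (windsor_candies H + 2)"
    if "(d, H) \<in> winning_moves K" for d H
  proof -
    have "(2::nat) ^ (windsor_candies H + d) \<le> 2 ^ m"
      using reply(2) [OF that] by (intro power_increasing) simp_all
    moreover have "(2::nat) ^ (windsor_candies H + 2) = 2 * 2 ^ Suc (windsor_candies H)"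
      by simp
    ultimately show ?thesis
      using N NK reply(4,5) [OF that] by linarith
  qed
  have d2: "d \<le> 2" if "(d, H) \<in> winning_moves K" for d H
    using bound [OF that] power2_growth_from_3 [of d "windsor_candies H"] by linarith
  obtain a S where G: "G = add_mset a S" "K = add_mset (a - c) S" "0 < c" "c \<le> a"
    using cK by (auto simp: moves_iff)
  have S: "nim_sum S = a" "a \<le> candies S"
    using P unfolding G by (auto dest: nim_sum_eq_if_P_add_mset pile_le_half_if_P)
  show ?case
  proof (cases "\<exists>H. (2, H) \<in> winning_moves K")
    case True
    then obtain H where H: "(2, H) \<in> winning_moves K"
      by blast
    define w where "w = windsor_candies H"
    have "(2::nat) ^ (w + 2) \<le> 2 ^ m"
      using reply(2) [OF H] w_def by (intro power_increasing) simp_all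
    then have w: "2 ^ (w + 2) \<le> candies G" "candies K = 2 + candies H" "candies H + 2 \<le> 2 ^ (w + 1)"
      using N reply [OF H] w_def by simp_all
    then have NG: "candies G = 2 ^ (w + 2)" "candies K = 2 ^ (w + 1)"
      using NK by simp_all
    then have "a - c = 0" "a = 2 ^ (w + 1)" "candies S = 2 ^ (w + 1)"
      using G S by simp_all
    then obtain Z where Z: "S = add_mset (2 ^ (w + 1)) Z" "candies Z = 0"
      using single_pile_if_power [of S "w + 1"] S by metis
    have "nim_sum K = 2 ^ (w + 1)"
      unfolding G(2) \<open>a - c = 0\<close> using S \<open>a = 2 ^ (w + 1)\<close> by simp
    then have "2 ^ (w + 1) \<le> (2::nat)"
      using d2 winning_moveI [of "2 ^ (w + 1)" K] Z G(2) by simp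
    then have "w = 0"
      using power_increasing_iff [of "2::nat" "w + 1" 1] by simp
    then have "m = 2"
      using N NG reply(2) [OF H] w_def power_increasing_iff [of "2::nat" m 2] by simp
    moreover have "G = add_mset 2 (add_mset 2 Z)"
      using G Z \<open>a = 2 ^ (w + 1)\<close> \<open>w = 0\<close> by simp
    ultimately show ?thesis
      using extremal_two_two Z m_def by simp
  next
    case False
    have d1: "d = 1" if "(d, H) \<in> winning_moves K" for d H
    proof -
      have "d \<noteq> 2"
        using that False by blast
      then show ?thesis
        using d2 [OF that] reply(1) [OF that] by simp
    qed
    obtain H where H: "(1, H) \<in> winning_moves K"
      using winning_moves_nonempty [OF notP] d1 by fastforce
    obtain m' where m': "m = Suc m'"
      using reply(2) [OF H] by (cases m) auto
    show ?thesis
    proof (cases "candies H = 0")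
      case True
      then have "candies K = 1"
        using reply(4) [OF H] by simp
      then have *: "a = 2 ^ 0" "candies S = 2 ^ 0"
        using NK G S by auto
      then obtain Z where Z: "S = add_mset (2 ^ 0) Z" "candies Z = 0"
        using single_pile_if_power [of S 0] S by metis
      have "candies G = 2"
        using G * by simp
      then have "m = 1"
        using N m' power_increasing_iff [of "2::nat" m 1] by simp
      then show ?thesis
        using G * Z m_def extremal_one_one by simp
    next
      case False
      have tight: "windsor_candies H' = m' \<and> 1 \<le> m' \<and> extremal m' H'"
        if H': "(d, H') \<in> winning_moves K" for d H'
      proof -
        note R = reply [OF H'] d1 [OF H']
        have "candies H' = candies H"
          using R reply(4) [OF H] by simp
        moreover have "even (candies H')"
          using R even_candies_if_P by blast
        ultimately have "2 \<le> candies H'"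
          using False by (auto elim!: evenE)
        have "2 ^ m' \<le> 1 + candies H'"
          using N NK R m' by simp
        \<comment> \<open>Both sides are even unless \<open>m' = 0\<close>, so the summand \<open>1\<close> can be dropped.\<close>
        then have le: "2 ^ m' \<le> candies H'"
          using \<open>even (candies H')\<close> \<open>2 \<le> candies H'\<close>
          by (cases m') (auto elim!: evenE)
        then have "(2::nat) ^ m' < 2 ^ Suc (windsor_candies H')"
          using R(5) by simp
        then have "m' < Suc (windsor_candies H')"
          by (rule power_less_imp_less_exp [rotated]) simp
        then have w: "windsor_candies H' = m'"
          using R m' by simp
        have "1 \<le> m'"
          using R(5) \<open>2 \<le> candies H'\<close> unfolding w by (cases m') auto
        moreover have "candies H' < candies G"
          using R candies_move [OF cK] by simp
        ultimately show ?thesis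
          using less.hyps [of H'] le w R(3) by simp
      qed
      obtain x x' y R where *: "G = add_mset x (add_mset (Suc y) R)"
        "K = add_mset x' (add_mset (Suc y) R)" "H = add_mset x' (add_mset y R)"
        "x = x' XOR (Suc y XOR y)" "x' < x"
        using reply_decomposition [OF P cK H] .
      have "extremal (Suc m') G"
        unfolding *(1)
      proof (rule extremal_step)
        show "1 \<le> m'" "extremal m' (add_mset x' (add_mset y R))"
          using tight [OF H] *(3) by auto
        show "P_position (add_mset x' (add_mset y R))"
          using reply(3) [OF H] *(3) by simp
        show "2 ^ Suc m' \<le> candies (add_mset x (add_mset (Suc y) R))"
          using N m' *(1) by simp
        show "d = 1 \<and> extremal m' H'"
          if "(d, H') \<in> winning_moves (add_mset x' (add_mset (Suc y) R))" for d H'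
          using that d1 tight unfolding *(2) [symmetric] by blast
      qed (use * in auto)
      then show ?thesis
        using m' m_def by simp
    qed
  qed
qed

lemma windsor_candies_le_if_extremal:
  assumes "extremal m G" "0 < m"
  shows "windsor_candies G \<le> m"
proof -
  obtain m' where m': "m = Suc m'"
    using assms(2) gr0_implies_Suc by blast
  have "windsor_candies (arrangement3 (Suc m) k) \<le> m" if "0 < k" "k < m" for k
    using that windsor_candies_arrangement3 [of "k - 1" m'] by (simp add: m')
  then show ?thesis
    using assms(1) windsor_candies_arrangement1 [of m'] windsor_candies_arrangement2 [of m]
    unfolding extremal_def m' by (auto dest!: windsor_candies_same_position)
qed

lemma candies_ge_if_extremal:
  assumes "extremal m G" "0 < m"
  shows "2 ^ m \<le> candies G"
proof -
  have m: "2 \<le> (2::nat) ^ m"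
    using assms(2) power_increasing [of 1 m "2::nat"] by simp
  have "2 ^ m \<le> candies (arrangement3 (Suc m) k)" if "0 < k" "k < m" for k
  proof -
    have "(2::nat) * 2 ^ k \<le> 2 ^ m" "2 \<le> (2::nat) ^ k"
      using that power_increasing [of "Suc k" m "2::nat"] power_increasing [of 1 k "2::nat"] by simp_all
    then show ?thesis
      using that candies_arrangement3 [of k "Suc m"] by simp
  qed
  then show ?thesis
    using assms candies_arrangement1 [of m] candies_arrangement2 [of "Suc m"] m
    unfolding extremal_def by (auto dest!: candies_same_position)
qed

theorem theorem6p7:
  fixes G :: position
  assumes "candies G \<ge> 1"
  shows "int (windsor_candies G) \<ge> \<lfloor>log 2 (real (candies G))\<rfloor> \<and>
    (int (windsor_candies G) = \<lfloor>log 2 (real (candies G))\<rfloor> \<longleftrightarrow>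
      (\<exists>n::nat. n > 0 \<and> candies G = 2 ^ n \<and> same_position G (arrangement1 n)) \<or>
      (\<exists>n::nat. n > 0 \<and> candies G = 2 ^ n - 2 \<and> same_position G (arrangement2 n)) \<or>
      (\<exists>n k::nat. n > 0 \<and> k > 0 \<and> n > k + 1 \<and> n > 2 \<and>
         candies G = 2 ^ n - 2 ^ k - 2 \<and> same_position G (arrangement3 n k)))"
    (is "?bound \<and> (?eq \<longleftrightarrow> ?A1 \<or> ?A2 \<or> ?A3)")
proof -
  let ?W = "windsor_candies G"
  have less: "candies G < 2 ^ Suc ?W"
    using candies_less_power_windsor by blast
  obtain w where w: "2 ^ w \<le> candies G" "candies G < 2 ^ Suc w"
    using ex_power_ivl1 [of 2 "candies G"] assms by auto
  then have "\<lfloor>log 2 (real (candies G))\<rfloor> = int w"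
    using floor_log_eq_iff [of "candies G" w] assms by simp
  moreover have "(2::nat) ^ w < 2 ^ Suc ?W"
    using w less by linarith
  then have "w < Suc ?W"
    by (rule power_less_imp_less_exp [rotated]) simp
  ultimately have bound: ?bound
    by simp
  have eq: "?eq \<longleftrightarrow> 2 ^ ?W \<le> candies G"
    using floor_log_eq_iff [of "candies G" ?W] assms less by auto
  have ext: "?A1 \<or> ?A2 \<or> ?A3 \<longleftrightarrow> (\<exists>m>0. extremal m G)"
  proof
    assume "?A1 \<or> ?A2 \<or> ?A3"
    then show "\<exists>m>0. extremal m G"
    proof (elim disjE exE conjE)
      fix n :: nat
      assume "n > 0" "same_position G (arrangement1 n)"
      then show ?thesis
        unfolding extremal_def by blast
    next
      fix n :: nat
      assume n: "n > 0" "candies G = 2 ^ n - 2" "same_position G (arrangement2 n)"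
      then have "n \<noteq> 1"
        using assms by auto
      then obtain m where "n = Suc m" "0 < m"
        using n(1) by (cases n) auto
      then show ?thesis
        using n unfolding extremal_def by blast
    next
      fix n k :: nat
      assume n: "k > 0" "n > k + 1" "same_position G (arrangement3 n k)"
      then obtain m where "n = Suc m" "k < m"
        by (cases n) auto
      moreover have "0 < m"
        using \<open>k < m\<close> by simp
      ultimately show ?thesis
        using n unfolding extremal_def by blast
    qed
  next
    assume "\<exists>m>0. extremal m G"
    then obtain m where m: "m > 0" "extremal m G"
      by blast
    then consider "same_position G (arrangement1 m)" | "same_position G (arrangement2 (Suc m))"
      | k where "0 < k" "k < m" "same_position G (arrangement3 (Suc m) k)"
      unfolding extremal_def by blast
    then show "?A1 \<or> ?A2 \<or> ?A3"
    proof cases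
      case 1
      then have ?A1
        using m(1) candies_same_position [OF 1] candies_arrangement1 by auto
      then show ?thesis ..
    next
      case 2
      have "candies G = 2 ^ Suc m - 2"
        using candies_same_position [OF 2] candies_arrangement2 [of "Suc m"] by simp
      with 2 have ?A2
        by (intro exI [of _ "Suc m"] conjI) simp_all
      then show ?thesis by blast
    next
      case 3
      then have "candies G = 2 ^ Suc m - 2 ^ k - 2"
        using candies_same_position [OF 3(3)] candies_arrangement3 [of k "Suc m"] by simp
      moreover have "k + 1 < Suc m" "2 < Suc m"
        using 3 by simp_all
      ultimately have ?A3
        using 3 by (intro exI [of _ "Suc m"] exI [of _ k] conjI) simp_all
      then show ?thesis by blast
    qed
  qed
  have "2 ^ ?W \<le> candies G \<longleftrightarrow> (\<exists>m>0. extremal m G)"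
  proof
    assume tight: "2 ^ ?W \<le> candies G"
    have P: "P_position G"
      using candies_less_power_windsor [of G] tight by (meson not_less)
    have "candies G \<noteq> 1"
      using even_candies_if_P [OF P] by auto
    have "?W \<noteq> 0"
    proof
      assume "?W = 0"
      with less have "candies G < 2"
        by simp
      with assms \<open>candies G \<noteq> 1\<close> show False
        by simp
    qed
    then show "\<exists>m>0. extremal m G"
      using extremal_if_tight [OF P tight] by blast
  next
    assume "\<exists>m>0. extremal m G"
    then obtain m where "m > 0" "extremal m G"
      by blast
    then have "?W \<le> m" "2 ^ m \<le> candies G"
      using windsor_candies_le_if_extremal candies_ge_if_extremal by blast+
    moreover from this have "(2::nat) ^ ?W \<le> 2 ^ m"
      by (intro power_increasing) simp_all
    ultimately show "2 ^ ?W \<le> candies G"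
      by linarith
  qed
  with bound eq ext show ?thesis
    by blast
qed

end
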